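(* For the CLTSP restricted to instances with zero processing times ($\tau(a)=0$ for all $a$), no time constraints ($r(a)=0$, $d(a)=\infty$ for all $a$) and slow clients ($0<v<1$), there exists an algorithm that computes an optimal solution in $O(n)$ time.
   Context: An instance of the line traveling salesman problem with collaboration (CLTSP) consists of a finite set $A$ of clients, $n=|A|$, a client speed $v>0$, and for each client $a\in A$ a starting position $s(a)\in\mathbb{R}$, a release date $r(a)\in\mathbb{R}_{\ge 0}$, a deadline $d(a)\in\mathbb{R}_{\ge0}\cup\{\infty\}$ and a processing time $\tau(a)\in\mathbb{R}_{\ge0}$. A single server starts at time $0$ at position $0$ and moves along the real line with speed at most $1$ (it may wait). Client $a$ is at position $s(a)$ at time $r(a)$ and from then on can move along the line with speed at most $v$ (or wait). A solution is a pair $(t,x)$ of maps $t:A\to\mathbb{R}_{\ge0}$, $x:A\to\mathbb{R}$, where $(t(a),x(a))$ is the time and position of the rendezvous of the server with client $a$. Let $\sigma_1,\dots,\sigma_n$ be the clients ordered by rendezvous time, put $(t_i,x_i)=(t(\sigma_i),x(\sigma_i))$ for $1\le i\le n$, $(t_0,x_0)=(0,0)$, and let $(t_{n+1},x_{n+1})$ be the time and position at which the server ends. Completion times are $c_0=0$, $c_i=t_i+\tau(\sigma_i)$ for $1\le i\le n$, $c_{n+1}=t_{n+1}$. The solution is feasible if $x_{n+1}=0$; $t_i\ge c_{i-1}+|x_i-x_{i-1}|$ for all $1\le i\le n+1$; $t(a)\ge r(a)+|x(a)-s(a)|/v$ for all $a\in A$; and $r(a)\le t(a)\le d(a)$ for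 all $a$. The makespan is $C_{\max}(t,x)=c_{n+1}$; the CLTSP asks for a feasible solution of minimum makespan (an optimal solution). *)

theory Defs
  imports Complex_Main "HOL-Library.Extended_Real" "HOL-Library.Landau_Symbols"
begin

section \<open>The line traveling salesman problem with collaboration\<close>

record 'a cltsp =
  clients  :: "'a set"
  speed    :: real
  start    :: "'a \<Rightarrow> real"
  release  :: "'a \<Rightarrow> real"
  deadline :: "'a \<Rightarrow> ereal"
  proc     :: "'a \<Rightarrow> real"

definition cltsp_instance :: "'a cltsp \<Rightarrow> bool" where
  "cltsp_instance I \<longleftrightarrow>
     finite (clients I) \<and> speed I > 0 \<and>
     (\<forall>a\<in>clients I. release I a \<ge> 0 \<and> deadline I a \<ge> 0 \<and> proc I a \<ge> 0)"

text \<open>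
  A solution consists of the rendezvous maps \<open>t\<close> and \<open>x\<close>, together with the time and
  position at which the server ends. Only the values on the client set are relevant.
\<close>

record 'a solution =
  rdv_time :: "'a \<Rightarrow> real"
  rdv_pos  :: "'a \<Rightarrow> real"
  end_time :: real
  end_pos  :: real

text \<open>
  The sequences \<open>t\<^sub>i\<close>, \<open>x\<^sub>i\<close>, \<open>c\<^sub>i\<close> for \<open>0 \<le> i \<le> n + 1\<close>, for the clients in the order
  given by the list \<open>\<sigma>\<close> of length \<open>n\<close>; the \<open>i\<close>-th client is the list element \<open>\<sigma> ! (i - 1)\<close>.
\<close>

definition stop_time :: "'a solution \<Rightarrow> 'a list \<Rightarrow> nat \<Rightarrow> real" where
  "stop_time S \<sigma> i =
     (if i = 0 then 0 else if i \<le> length \<sigma> then rdv_time S (\<sigma> ! (i - 1)) else end_time S)"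

definition stop_pos :: "'a solution \<Rightarrow> 'a list \<Rightarrow> nat \<Rightarrow> real" where
  "stop_pos S \<sigma> i =
     (if i = 0 then 0 else if i \<le> length \<sigma> then rdv_pos S (\<sigma> ! (i - 1)) else end_pos S)"

definition completion :: "'a cltsp \<Rightarrow> 'a solution \<Rightarrow> 'a list \<Rightarrow> nat \<Rightarrow> real" where
  "completion I S \<sigma> i =
     (if 1 \<le> i \<and> i \<le> length \<sigma> then stop_time S \<sigma> i + proc I (\<sigma> ! (i - 1))
      else stop_time S \<sigma> i)"

definition rdv_order :: "'a cltsp \<Rightarrow> 'a solution \<Rightarrow> 'a list \<Rightarrow> bool" where
  "rdv_order I S \<sigma> \<longleftrightarrow>
     distinct \<sigma> \<and> set \<sigma> = clients I \<and> sorted (map (rdv_time S) \<sigma>)"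

text \<open>
  Clients with equal rendezvous times may be ordered in any way; a solution is feasible if
  the server can follow one of these orders.
\<close>

definition feasible :: "'a cltsp \<Rightarrow> 'a solution \<Rightarrow> bool" where
  "feasible I S \<longleftrightarrow>
     (\<forall>a\<in>clients I. rdv_time S a \<ge> 0) \<and>
     (\<exists>\<sigma>. rdv_order I S \<sigma> \<and>
        (\<forall>i. 1 \<le> i \<and> i \<le> card (clients I) + 1 \<longrightarrow>
           stop_time S \<sigma> i \<ge>
             completion I S \<sigma> (i - 1) + \<bar>stop_pos S \<sigma> i - stop_pos S \<sigma> (i - 1)\<bar>)) \<and>
     end_pos S = 0 \<and>
     (\<forall>a\<in>clients I. rdv_time S a \<ge> release I a + \<bar>rdv_pos S a - start I a\<bar> / speed I) \<and>
     (\<forall>a\<in>clients I. release I a \<le> rdv_time S a \<and> ereal (rdv_time S a) \<le> deadline I a)"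

text \<open>This is \<open>c\<^bsub>n+1\<^esub> = t\<^bsub>n+1\<^esub>\<close>, which does not depend on the order of the clients.\<close>

definition makespan :: "'a solution \<Rightarrow> real" where
  "makespan S = end_time S"

definition optimal :: "'a cltsp \<Rightarrow> 'a solution \<Rightarrow> bool" where
  "optimal I S \<longleftrightarrow> feasible I S \<and> (\<forall>S'. feasible I S' \<longrightarrow> makespan S \<le> makespan S')"


section \<open>A real random access machine with unit costs\<close>

text \<open>
  The machine has index registers holding natural numbers, registers holding reals, and an
  array of real memory cells that is addressed indirectly through the index registers.
  Every instruction costs one step. Reals are processed exactly, but only by
  \<open>+\<close>, \<open>-\<close>, \<open>*\<close>, \<open>/\<close>, comparison, and loading of integer constants. There is no rounding,
  no conversion between reals and indices, and no multiplication of indices.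
\<close>

datatype instr =
    IConst nat nat
  | IMove nat nat
  | IAdd nat nat nat
  | ISub nat nat nat
  | IJumpLess nat nat nat
  | RConst nat int
  | RMove nat nat
  | RAdd nat nat nat
  | RSub nat nat nat
  | RMul nat nat nat
  | RDiv nat nat nat
  | RJumpLess nat nat nat
  | Load nat nat
  | Store nat nat
  | Jump nat
  | Halt

record config =
  pc   :: nat
  ireg :: "nat \<Rightarrow> nat"
  rreg :: "nat \<Rightarrow> real"
  mem  :: "nat \<Rightarrow> real"

definition set_ireg :: "config \<Rightarrow> nat \<Rightarrow> nat \<Rightarrow> config" where
  "set_ireg c i k = c\<lparr>pc := pc c + 1, ireg := (ireg c)(i := k)\<rparr>"

definition set_rreg :: "config \<Rightarrow> nat \<Rightarrow> real \<Rightarrow> config" where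
  "set_rreg c i y = c\<lparr>pc := pc c + 1, rreg := (rreg c)(i := y)\<rparr>"

definition set_mem :: "config \<Rightarrow> nat \<Rightarrow> real \<Rightarrow> config" where
  "set_mem c i y = c\<lparr>pc := pc c + 1, mem := (mem c)(i := y)\<rparr>"

definition branch :: "config \<Rightarrow> bool \<Rightarrow> nat \<Rightarrow> config" where
  "branch c b l = c\<lparr>pc := (if b then l else pc c + 1)\<rparr>"

text \<open>
  The first argument of an instruction is its target, except that \<open>Store i j\<close> writes real
  register \<open>j\<close> to the cell addressed by index register \<open>i\<close>, and that the target of a
  conditional jump comes last. Subtraction of indices is truncated at 0. The value \<open>None\<close>
  means that there is no successor configuration; division by zero is such a case.
\<close>

fun exec :: "instr \<Rightarrow> config \<Rightarrow> config option" where
  "exec (IConst i k) c = Some (set_ireg c i k)"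
| "exec (IMove i j) c = Some (set_ireg c i (ireg c j))"
| "exec (IAdd i j k) c = Some (set_ireg c i (ireg c j + ireg c k))"
| "exec (ISub i j k) c = Some (set_ireg c i (ireg c j - ireg c k))"
| "exec (IJumpLess i j l) c = Some (branch c (ireg c i < ireg c j) l)"
| "exec (RConst i z) c = Some (set_rreg c i (of_int z))"
| "exec (RMove i j) c = Some (set_rreg c i (rreg c j))"
| "exec (RAdd i j k) c = Some (set_rreg c i (rreg c j + rreg c k))"
| "exec (RSub i j k) c = Some (set_rreg c i (rreg c j - rreg c k))"
| "exec (RMul i j k) c = Some (set_rreg c i (rreg c j * rreg c k))"
| "exec (RDiv i j k) c =
     (if rreg c k = 0 then None else Some (set_rreg c i (rreg c j / rreg c k)))"
| "exec (RJumpLess i j l) c = Some (branch c (rreg c i < rreg c j) l)"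
| "exec (Load i j) c = Some (set_rreg c i (mem c (ireg c j)))"
| "exec (Store i j) c = Some (set_mem c (ireg c i) (rreg c j))"
| "exec (Jump l) c = Some (branch c True l)"
| "exec Halt c = None"

definition step :: "instr list \<Rightarrow> config \<Rightarrow> config option" where
  "step P c = (if pc c < length P then exec (P ! pc c) c else None)"

fun run :: "instr list \<Rightarrow> nat \<Rightarrow> config \<Rightarrow> config option" where
  "run P 0 c = Some c"
| "run P (Suc k) c = (case step P c of None \<Rightarrow> None | Some c' \<Rightarrow> run P k c')"

definition halts_within :: "instr list \<Rightarrow> nat \<Rightarrow> config \<Rightarrow> config \<Rightarrow> bool" where
  "halts_within P b c c' \<longleftrightarrow>
     (\<exists>k\<le>b. run P k c = Some c') \<and> pc c' < length P \<and> P ! pc c' = Halt"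


section \<open>Input and output of an algorithm\<close>

text \<open>
  The input lists the clients in an arbitrary order. Index register 0 holds \<open>n\<close>, real
  register 0 holds \<open>v\<close>, and cells \<open>0, \<dots>, n - 1\<close> hold the starting positions; all else is 0.
  Release dates, deadlines and processing times are not part of the input, as they are the
  same for all instances of the restricted problem.
\<close>

definition input_config :: "'a cltsp \<Rightarrow> 'a list \<Rightarrow> config" where
  "input_config I as =
     \<lparr>pc = 0,
      ireg = (\<lambda>_. 0)(0 := length as),
      rreg = (\<lambda>_. 0)(0 := speed I),
      mem = (\<lambda>i. if i < length as then start I (as ! i) else 0)\<rparr>"

definition output_solution :: "'a list \<Rightarrow> config \<Rightarrow> 'a solution \<Rightarrow> bool" where
  "output_solution as c S \<longleftrightarrow>
     (let n = length as in
       (\<forall>i<n. rdv_time S (as ! i) = mem c i \<and> rdv_pos S (as ! i) = mem c (n + i)) \<and>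
       end_time S = mem c (2 * n) \<and> end_pos S = mem c (2 * n + 1))"

text \<open>
  Program \<open>P\<close> computes an optimal solution of every instance satisfying \<open>Q\<close>, for every
  order in which its \<open>n\<close> clients are listed, in at most \<open>T n\<close> steps.
\<close>

definition computes_optimal_within ::
    "instr list \<Rightarrow> ('a cltsp \<Rightarrow> bool) \<Rightarrow> (nat \<Rightarrow> nat) \<Rightarrow> bool" where
  "computes_optimal_within P Q T \<longleftrightarrow>
     (\<forall>I as. cltsp_instance I \<and> Q I \<and> distinct as \<and> set as = clients I \<longrightarrow>
       (\<exists>c S. halts_within P (T (card (clients I))) (input_config I as) c \<and>
              output_solution as c S \<and> optimal I S))"

end

theory Submission
  imports Defs
begin

text \<open>
  Only the extreme clients matter. Let \<open>F \<ge> G \<ge> 0\<close> be the distances from the origin to the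
  farthest clients on the two sides. The server first runs towards the client at distance \<open>F\<close>,
  meets it at distance \<open>p = F / (1 + v)\<close>, returns to the origin at time \<open>2 * p\<close>, and then meets
  the other extreme client at distance \<open>q\<close>, where \<open>q\<close> is \<open>(G - 2 * v * p) / (1 + v)\<close>, or \<open>0\<close> if
  that client can be back at the origin by time \<open>2 * p\<close>. All other clients wait on the server's
  way or move to one of its two turning points. Conversely, the meetings with the two extreme
  clients alone force every tour to take time \<open>2 * p + 2 * q\<close>, and serving the nearer side first
  is never better. The machine needs one pass for the two extremes and one for the output.
\<close>

section \<open>Lower bound\<close>

text \<open>Meeting the client from \<open>a\<close> and returning to the origin takes at least
  \<open>2 * a / (1 + v)\<close>, time in which the client from \<open>- b\<close> can approach as
  well. Both bounds are such tour lengths, cleared of denominators.\<close>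

lemma two_stops_bound:
  fixes v a b :: real
  assumes v: "0 < v" "v < 1"
    and first: "\<bar>x\<bar> \<le> t" "a - v * t \<le> x"
    and second: "t + \<bar>x' - x\<bar> \<le> t'" "x' \<le> v * t' - b"
    and last: "t' + \<bar>x'\<bar> \<le> T"
  shows "2 * a \<le> (1 + v) * T"
    and "2 * ((1 - v) * a + (1 + v) * b) \<le> (1 + v)\<^sup>2 * T"
proof -
  \<comment> \<open>Add \<open>(1 - v) * (t - x) >= 0\<close> to twice the reach condition
    \<open>a <= x + v * t\<close>.\<close>
  have home: "2 * a \<le> (1 + v) * (t + x)"
  proof -
    have "(1 - v) * x \<le> (1 - v) * t"
      using v first by (intro mult_left_mono) auto
    then show ?thesis using first by (simp add: algebra_simps)
  qed
  have T: "t + x \<le> T" using second last by linarith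
  have "(1 + v) * (t + x) \<le> (1 + v) * T"
    using T v by (intro mult_left_mono) auto
  then show a: "2 * a \<le> (1 + v) * T" using home by linarith
  show "2 * ((1 - v) * a + (1 + v) * b) \<le> (1 + v)\<^sup>2 * T"
  \<comment> \<open>If the second meeting is not on the negative side, its client has covered all of
    \<open>b\<close>, so \<open>b <= v * T\<close>. Otherwise the server has to be at the origin by
    \<open>t' - y\<close>, and \<open>home\<close> bounds \<open>a\<close> by that time.\<close>
  proof (cases "0 \<le> x'")
    case True
    have "b \<le> v * T"
    proof -
      have "v * t' \<le> v * T" using v last by (intro mult_left_mono) auto
      then show ?thesis using second True by linarith
    qed
    then have "(1 + v) * (2 * b) \<le> (1 + v) * (2 * v * T)"
      using v by (intro mult_left_mono) auto
    moreover have "(1 - v) * (2 * a) \<le> (1 - v) * ((1 + v) * T)"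
      using a v by (intro mult_left_mono) auto
    ultimately show ?thesis by (simp add: algebra_simps power2_eq_square)
  next
    case False
    define y where "y = - x'"
    have y: "t + x + y \<le> t'" "b \<le> v * t' + y" "t' + y \<le> T"
      using False second last by (auto simp: y_def)
    have "(1 + v) * (t + x) \<le> (1 + v) * (t' - y)"
      using y v by (intro mult_left_mono) auto
    then have "2 * a \<le> (1 + v) * (t' - y)" using home by linarith
    then have "(1 - v) * (2 * a) \<le> (1 - v) * ((1 + v) * (t' - y))"
      using v by (intro mult_left_mono) auto
    moreover have "(1 + v) * (2 * b) \<le> (1 + v) * (2 * (v * t' + y))"
      using y v by (intro mult_left_mono) auto
    moreover have "(1 + v)\<^sup>2 * (t' + y) \<le> (1 + v)\<^sup>2 * T"
      using y by (intro mult_left_mono) auto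
    ultimately show ?thesis by (simp add: algebra_simps power2_eq_square)
  qed
qed

definition turn1 :: "real \<Rightarrow> real \<Rightarrow> real" where
  "turn1 v F = F / (1 + v)"

definition turn2 :: "real \<Rightarrow> real \<Rightarrow> real \<Rightarrow> real" where
  "turn2 v F G = max 0 ((G - v * (2 * turn1 v F)) / (1 + v))"

text \<open>The maximum in \<open>turn2\<close> leaves two cases; the two assumptions on
  \<open>T\<close> are the respective tour lengths, multiplied by \<open>1 + v\<close> and by its
  square.\<close>

lemma tour_length_le:
  fixes v F G :: real
  assumes v: "0 < v"
    and T: "2 * F \<le> (1 + v) * T" "2 * ((1 - v) * F + (1 + v) * G) \<le> (1 + v)\<^sup>2 * T"
  shows "2 * turn1 v F + 2 * turn2 v F G \<le> T"
proof -
  have "2 * turn1 v F \<le> T"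
    using v T(1) by (simp add: turn1_def field_simps)
  moreover have "2 * turn1 v F + 2 * ((G - v * (2 * turn1 v F)) / (1 + v)) =
      2 * ((1 - v) * F + (1 + v) * G) / (1 + v)\<^sup>2"
    using v by (simp add: turn1_def divide_simps) (simp add: algebra_simps power2_eq_square)
  moreover have "\<dots> \<le> T"
    using v T(2) by (simp add: divide_simps mult.commute)
  ultimately show ?thesis by (simp add: turn2_def max_def)
qed

text \<open>Mirroring the line reduces the order with the nearer side first to
  \<open>two_stops_bound\<close> with \<open>F\<close> and \<open>G\<close> exchanged. The exchanged
  second bound implies both original ones because \<open>0 <= G <= F\<close>.\<close>

lemma tour_length_le_two_stops:
  fixes v F G :: real
  assumes v: "0 < v" "v < 1" and FG: "0 \<le> G" "G \<le> F"
    and stops: "\<bar>x\<bar> \<le> t" "\<bar>x'\<bar> \<le> t'" "t + \<bar>x\<bar> \<le> T" "t' + \<bar>x'\<bar> \<le> T"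
      "t + \<bar>x' - x\<bar> \<le> t' \<or> t' + \<bar>x' - x\<bar> \<le> t"
    and reach: "F - v * t \<le> x" "x' \<le> v * t' - G"
  shows "2 * turn1 v F + 2 * turn2 v F G \<le> T"
  using stops(5)
proof
  assume order: "t + \<bar>x' - x\<bar> \<le> t'"
  show ?thesis
    by (rule tour_length_le[OF v(1)
          two_stops_bound[OF v stops(1) reach(1) order reach(2) stops(4)]])
next
  assume "t' + \<bar>x' - x\<bar> \<le> t"
  then have *: "2 * G \<le> (1 + v) * T" "2 * ((1 - v) * G + (1 + v) * F) \<le> (1 + v)\<^sup>2 * T"
    using v FG stops(2,3) reach two_stops_bound[of v "- x'" t' G "- x" t F T]
    by (simp_all add: abs_minus_commute)
  have vG: "v * G \<le> G" using FG v by (simp add: mult_left_le_one_le)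
  have vFG: "v * G \<le> v * F" using FG v by simp
  show ?thesis
  proof (rule tour_length_le)
    have "(1 + v) * (2 * F) \<le> 2 * ((1 - v) * G + (1 + v) * F)"
      using vG by (simp add: algebra_simps)
    then have "(1 + v) * (2 * F) \<le> (1 + v) * ((1 + v) * T)"
      using * by (simp add: power2_eq_square algebra_simps)
    then show "2 * F \<le> (1 + v) * T"
      using v by (simp add: mult_le_cancel_left)
    show "2 * ((1 - v) * F + (1 + v) * G) \<le> (1 + v)\<^sup>2 * T"
      using *(2) vFG by (simp add: algebra_simps)
  qed (use v in auto)
qed

section \<open>From feasible solutions to pairs of stops\<close>

lemma stops_lipschitz:
  fixes t x :: "nat \<Rightarrow> real"
  assumes "\<And>k. i \<le> k \<Longrightarrow> k < j \<Longrightarrow> t k + \<bar>x (Suc k) - x k\<bar> \<le> t (Suc k)" and "i \<le> j"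
  shows "t i + \<bar>x j - x i\<bar> \<le> t j"
  using assms(2,1)
proof (induction j rule: dec_induct)
  case (step j)
  then have "t i + \<bar>x j - x i\<bar> \<le> t j" "t j + \<bar>x (Suc j) - x j\<bar> \<le> t (Suc j)" by auto
  then show ?case by linarith
qed simp

definition timeless :: "'a cltsp \<Rightarrow> bool" where
  "timeless I \<longleftrightarrow> (\<forall>a\<in>clients I. proc I a = 0) \<and>
     (\<forall>a\<in>clients I. release I a = 0 \<and> deadline I a = \<infinity>)"

lemma completion_timeless:
  assumes "timeless I" "rdv_order I S \<sigma>"
  shows "completion I S \<sigma> i = stop_time S \<sigma> i"
proof -
  have "\<sigma> ! (i - 1) \<in> clients I" if "1 \<le> i" "i \<le> length \<sigma>"
  proof -
    have "i - 1 < length \<sigma>" using that by linarith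
    then show ?thesis using assms(2) nth_mem unfolding rdv_order_def by blast
  qed
  then show ?thesis using assms(1) by (simp add: completion_def timeless_def)
qed

text \<open>The stop \<open>0\<close> at the origin takes the role of the farthest client on an empty side.\<close>

lemma extreme_stop:
  assumes I: "timeless I" "0 < speed I" and S: "feasible I S"
    and \<sigma>: "rdv_order I S \<sigma>"
    and F: "F = 0 \<or> (\<exists>a\<in>clients I. g * start I a = F)" and g: "\<bar>g\<bar> = 1"
  obtains i where "i \<le> length \<sigma>" "F - speed I * stop_time S \<sigma> i \<le> g * stop_pos S \<sigma> i"
  using F
proof
  assume "F = 0"
  then show thesis by (intro that[of 0]) (auto simp: stop_time_def stop_pos_def)
next
  assume "\<exists>a\<in>clients I. g * start I a = F"
  then obtain a where a: "a \<in> clients I" "g * start I a = F" by blast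
  then obtain k where k: "k < length \<sigma>" "\<sigma> ! k = a"
    using \<sigma> by (metis rdv_order_def in_set_conv_nth)
  have "\<bar>rdv_pos S a - start I a\<bar> / speed I \<le> rdv_time S a"
    using S a I unfolding feasible_def timeless_def by auto
  then have "\<bar>rdv_pos S a - start I a\<bar> \<le> speed I * rdv_time S a"
    using I by (simp add: field_simps)
  then have "\<bar>g * rdv_pos S a - F\<bar> \<le> speed I * rdv_time S a"
    using g by (simp add: abs_mult flip: a(2) right_diff_distrib)
  \<comment> \<open>List positions count from 0 but clients from stop 1, as stop 0 is the
    origin.\<close>
  then show thesis
    using k by (intro that[of "Suc k"]) (auto simp: stop_time_def stop_pos_def)
qed

text \<open>The sign \<open>g\<close> mirrors the line so that the farther extreme lies on the
  positive side. Only the stops that meet the two extremes are used; comparing them with the first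
  and the last stop, both at the origin, gives the departure and return conditions.\<close>

lemma feasible_makespan_ge:
  assumes I: "timeless I" "0 < speed I" "speed I < 1"
    and S: "feasible I S"
    and g: "\<bar>g\<bar> = 1" and FG: "0 \<le> G" "G \<le> F"
    and F: "F = 0 \<or> (\<exists>a\<in>clients I. g * start I a = F)"
    and G: "G = 0 \<or> (\<exists>a\<in>clients I. - g * start I a = G)"
  shows "2 * turn1 (speed I) F + 2 * turn2 (speed I) F G \<le> end_time S"
proof -
  obtain \<sigma> where \<sigma>: "rdv_order I S \<sigma>"
    and path: "\<And>i. 1 \<le> i \<Longrightarrow> i \<le> card (clients I) + 1 \<Longrightarrow>
      completion I S \<sigma> (i - 1) + \<bar>stop_pos S \<sigma> i - stop_pos S \<sigma> (i - 1)\<bar> \<le> stop_time S \<sigma> i"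
    using S unfolding feasible_def by blast
  let ?n = "length \<sigma>" and ?t = "stop_time S \<sigma>" and ?x = "stop_pos S \<sigma>"
  have n: "card (clients I) = ?n"
    using \<sigma> by (metis rdv_order_def distinct_card)
  note compl = completion_timeless[OF I(1) \<sigma>]
  have leg: "?t k + \<bar>?x (Suc k) - ?x k\<bar> \<le> ?t (Suc k)" if "k \<le> ?n" for k
    using path[of "Suc k"] that by (simp add: n compl)
  have lip: "?t i + \<bar>?x j - ?x i\<bar> \<le> ?t j" if "i \<le> j" "j \<le> Suc ?n" for i j
    by (rule stops_lipschitz[where t = ?t and x = ?x, OF leg]) (use that in linarith)+
  have origin: "?t 0 = 0" "?x 0 = 0" and final: "?t (Suc ?n) = end_time S" "?x (Suc ?n) = 0"
    using S by (simp_all add: stop_time_def stop_pos_def feasible_def)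
  obtain i where i: "i \<le> ?n" "F - speed I * ?t i \<le> g * ?x i"
    using extreme_stop[OF I(1,2) S \<sigma> F g] .
  obtain j where j: "j \<le> ?n" "G - speed I * ?t j \<le> - g * ?x j"
    using extreme_stop[OF I(1,2) S \<sigma> G] g unfolding abs_minus_cancel .
  have abs_g: "\<bar>g * y\<bar> = \<bar>y\<bar>" for y using g by (simp add: abs_mult)
  have abs_diff: "\<bar>g * y - g * z\<bar> = \<bar>y - z\<bar>" for y z
    using abs_g[of "y - z"] by (simp add: right_diff_distrib)
  show ?thesis
  proof (rule tour_length_le_two_stops[where x = "g * ?x i" and x' = "g * ?x j"
        and t = "?t i" and t' = "?t j"])
    show "?t i + \<bar>g * ?x j - g * ?x i\<bar> \<le> ?t j \<or> ?t j + \<bar>g * ?x j - g * ?x i\<bar> \<le> ?t i"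
      using lip[of i j] lip[of j i] i j
      by (cases "i \<le> j") (auto simp: abs_diff abs_minus_commute)
  qed (use I(2,3) FG i j lip[of 0 i] lip[of 0 j] lip[of i "Suc ?n"] lip[of j "Suc ?n"] in
      \<open>simp_all add: abs_g origin final\<close>)
qed

section \<open>The optimal tour\<close>

text \<open>
  Positions are measured in the direction of the farther side, so that \<open>y \<ge> 0\<close> are the clients
  served on the first leg.
\<close>

definition meet_pos :: "real \<Rightarrow> real \<Rightarrow> real \<Rightarrow> real" where
  "meet_pos p q y = (if y < 0 then max y (- q) else min y p)"

text \<open>Meetings take place on the outward half of a leg. The second leg starts at time
  \<open>2 * p\<close>, and subtracting its nonpositive position (for \<open>q >= 0\<close>) adds
  the distance.\<close>

definition meet_time :: "real \<Rightarrow> real \<Rightarrow> real \<Rightarrow> real" where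
  "meet_time p q y = (if y < 0 then 2 * p - max y (- q) else min y p)"

definition tour :: "'a cltsp \<Rightarrow> real \<Rightarrow> real \<Rightarrow> real \<Rightarrow> 'a solution" where
  "tour I g p q =
     \<lparr>rdv_time = \<lambda>a. meet_time p q (g * start I a),
      rdv_pos = \<lambda>a. g * meet_pos p q (g * start I a),
      end_time = 2 * p + 2 * q, end_pos = 0\<rparr>"

text \<open>All meetings lie on one path of speed 1: out to \<open>p\<close> and back, then out to
  \<open>- q\<close> and back. Hence any two of them are compatible, and equal times force equal
  positions.\<close>

lemma meet_path:
  assumes "0 \<le> p" "0 \<le> q"
  shows "\<bar>meet_pos p q y\<bar> \<le> meet_time p q y"
    and "meet_time p q y + \<bar>meet_pos p q y\<bar> \<le> 2 * p + 2 * q"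
    and "meet_time p q y \<le> meet_time p q z \<Longrightarrow>
      meet_time p q y + \<bar>meet_pos p q z - meet_pos p q y\<bar> \<le> meet_time p q z"
  using assms by (auto simp: meet_pos_def meet_time_def max_def min_def split: if_splits)

text \<open>Clients up to a turning point wait. With turning distances \<open>p\<close> and
  \<open>q\<close>, the others walk at most \<open>F - p = v * p\<close> or
  \<open>G - q <= v * (2 * p + q)\<close>.\<close>

lemma meet_reachable:
  assumes v: "0 < v" and F: "0 \<le> F" and y: "- G \<le> y" "y \<le> F"
  shows "\<bar>meet_pos (turn1 v F) (turn2 v F G) y - y\<bar>
    \<le> v * meet_time (turn1 v F) (turn2 v F G) y"
proof -
  let ?p = "turn1 v F" and ?q = "turn2 v F G"
  have p: "F = (1 + v) * ?p" "0 \<le> ?p" using v F by (auto simp: turn1_def)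
  have q: "0 \<le> ?q" by (simp add: turn2_def)
  have "(G - v * (2 * ?p)) / (1 + v) \<le> ?q" by (simp add: turn2_def)
  then have G: "G \<le> v * (2 * ?p) + (1 + v) * ?q"
    using v by (simp add: field_simps)
  show ?thesis
  proof (cases "y < 0")
    case True
    have "0 \<le> v * (2 * ?p - y)" using v p True by (intro mult_nonneg_nonneg) auto
    then show ?thesis using True G y
      by (auto simp: meet_pos_def meet_time_def max_def algebra_simps)
  next
    case False
    then have "0 \<le> v * y" using v by simp
    then show ?thesis using False p y
      by (auto simp: meet_pos_def meet_time_def min_def algebra_simps)
  qed
qed

text \<open>Since the travel condition is assumed for every pair of clients, any order sorted by
  rendezvous time is a witness.\<close>

lemma feasibleI_path:
  assumes I: "cltsp_instance I" "timeless I"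
    and "end_pos S = 0" "0 \<le> end_time S"
    and start: "\<And>a. a \<in> clients I \<Longrightarrow> \<bar>rdv_pos S a\<bar> \<le> rdv_time S a"
    and fin: "\<And>a. a \<in> clients I \<Longrightarrow> rdv_time S a + \<bar>rdv_pos S a\<bar> \<le> end_time S"
    and mid: "\<And>a b. a \<in> clients I \<Longrightarrow> b \<in> clients I \<Longrightarrow> rdv_time S a \<le> rdv_time S b \<Longrightarrow>
      rdv_time S a + \<bar>rdv_pos S b - rdv_pos S a\<bar> \<le> rdv_time S b"
    and reach: "\<And>a. a \<in> clients I \<Longrightarrow>
      \<bar>rdv_pos S a - start I a\<bar> \<le> speed I * rdv_time S a"
  shows "feasible I S"
proof -
  obtain as where as: "distinct as" "set as = clients I"
    using I finite_distinct_list unfolding cltsp_instance_def by metis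
  define \<sigma> where "\<sigma> = sort_key (rdv_time S) as"
  have \<sigma>: "rdv_order I S \<sigma>" using as by (simp add: rdv_order_def \<sigma>_def)
  have n: "card (clients I) = length \<sigma>"
    using \<sigma> by (metis rdv_order_def distinct_card)
  have mem: "\<sigma> ! k \<in> clients I" if "k < length \<sigma>" for k
    using \<sigma> that by (metis nth_mem rdv_order_def)
  have order: "rdv_time S (\<sigma> ! k) \<le> rdv_time S (\<sigma> ! l)" if "k \<le> l" "l < length \<sigma>" for k l
    using \<sigma> that sorted_nth_mono[of "map (rdv_time S) \<sigma>" k l] by (simp add: rdv_order_def)
  note compl = completion_timeless[OF I(2) \<sigma>]
  have "completion I S \<sigma> (i - 1) + \<bar>stop_pos S \<sigma> i - stop_pos S \<sigma> (i - 1)\<bar> \<le> stop_time S \<sigma> i"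
    if i: "1 \<le> i" "i \<le> card (clients I) + 1" for i
  proof -
    obtain k where k: "i = Suc k" using i by (cases i) auto
    \<comment> \<open>The legs are: origin to first client, origin to end without clients, client to
      client, last client to end.\<close>
    consider "k = 0" "i \<le> length \<sigma>" | "k = 0" "\<sigma> = []" | l where "k = Suc l" "i \<le> length \<sigma>"
      | l where "k = Suc l" "k = length \<sigma>"
      using i k n by (cases k) (auto simp: le_Suc_eq)
    then show ?thesis
    proof cases
      case 1
      then have "0 < length \<sigma>" using i k by linarith
      then show ?thesis using 1 k start[OF mem[of 0]]
        by (auto simp: compl stop_time_def stop_pos_def)
    next
      case 2
      then show ?thesis using k compl[of 0] assms(3,4)
        by (simp add: stop_time_def stop_pos_def)
    next
      case 3
      then show ?thesis using k mid[OF mem[of l] mem[of k] order[of l k]]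
        by (auto simp: compl stop_time_def stop_pos_def)
    next
      case 4
      then show ?thesis using k fin[OF mem[of l]] assms
        by (auto simp: compl stop_time_def stop_pos_def)
    qed
  qed
  moreover have "0 \<le> rdv_time S a" if "a \<in> clients I" for a
    using start[OF that] by linarith
  moreover have "\<bar>rdv_pos S a - start I a\<bar> / speed I \<le> rdv_time S a" if "a \<in> clients I" for a
    using reach[OF that] I by (simp add: cltsp_instance_def field_simps)
  ultimately show ?thesis
    using I \<sigma> assms unfolding feasible_def timeless_def by auto
qed

text \<open>The makespan of the tour equals the bound of \<open>feasible_makespan_ge\<close>, so
  only feasibility remains.\<close>

lemma tour_optimal:
  assumes I: "cltsp_instance I" "timeless I" "0 < speed I" "speed I < 1"
    and g: "\<bar>g\<bar> = 1" and FG: "0 \<le> G" "G \<le> F"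
    and F: "F = 0 \<or> (\<exists>a\<in>clients I. g * start I a = F)"
    and G: "G = 0 \<or> (\<exists>a\<in>clients I. - g * start I a = G)"
    and bounds: "\<And>a. a \<in> clients I \<Longrightarrow> - G \<le> g * start I a \<and> g * start I a \<le> F"
  shows "optimal I (tour I g (turn1 (speed I) F) (turn2 (speed I) F G))"
proof -
  let ?p = "turn1 (speed I) F" and ?q = "turn2 (speed I) F G"
  have pq: "0 \<le> ?p" "0 \<le> ?q" using I FG by (auto simp: turn1_def turn2_def)
  have gg: "g * (g * y) = y" and abs_g: "\<bar>g * y\<bar> = \<bar>y\<bar>" for y
    using g by (auto simp: abs_mult abs_if split: if_splits)
  have "feasible I (tour I g ?p ?q)"
  proof (rule feasibleI_path)
    fix a assume a: "a \<in> clients I"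
    let ?y = "g * start I a"
    have "\<bar>g * meet_pos ?p ?q ?y - start I a\<bar> = \<bar>meet_pos ?p ?q ?y - ?y\<bar>"
      using abs_g[of "g * meet_pos ?p ?q ?y - start I a"] by (simp add: right_diff_distrib gg)
    then show "\<bar>rdv_pos (tour I g ?p ?q) a - start I a\<bar> \<le> speed I * rdv_time (tour I g ?p ?q) a"
      using meet_reachable[of "speed I" F G ?y] bounds[OF a] I FG by (simp add: tour_def)
  qed (use I pq meet_path[OF pq] in
      \<open>auto simp: tour_def abs_g simp flip: right_diff_distrib\<close>)
  then show ?thesis
    using feasible_makespan_ge[OF I(2-4) _ g FG F G] by (auto simp: optimal_def makespan_def tour_def)
qed

section \<open>The program\<close>

definition reaches :: "instr list \<Rightarrow> nat \<Rightarrow> config \<Rightarrow> (config \<Rightarrow> bool) \<Rightarrow> bool" where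
  "reaches P b c Q \<longleftrightarrow> (\<exists>k\<le>b. \<exists>c'. run P k c = Some c' \<and> Q c')"

text \<open>The case form lets the simplifier execute all \<open>k\<close> steps symbolically once
  \<open>run_numeral\<close> unfolds the numeral.\<close>

lemma reaches_run:
  assumes "case run P k c of None \<Rightarrow> False | Some c' \<Rightarrow> Q c'" "k \<le> b"
  shows "reaches P b c Q"
  using assms unfolding reaches_def by (auto split: option.splits)

lemma run_numeral:
  "run P (numeral k) c =
    (case step P c of None \<Rightarrow> None | Some c' \<Rightarrow> run P (pred_numeral k) c')"
  by (simp add: numeral_eq_Suc)

lemma run_add: "run P j c = Some c' \<Longrightarrow> run P (j + k) c = run P k c'"
  by (induction j arbitrary: c) (auto split: option.splits)

lemma reaches_trans:
  assumes "reaches P b c Q" "\<And>d. Q d \<Longrightarrow> reaches P b' d R"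
  shows "reaches P (b + b') c R"
proof -
  obtain j d where j: "j \<le> b" "run P j c = Some d" "Q d"
    using assms(1) unfolding reaches_def by blast
  obtain k e where k: "k \<le> b'" "run P k d = Some e" "R e"
    using assms(2)[OF j(3)] unfolding reaches_def by blast
  show ?thesis
    unfolding reaches_def using j k run_add[OF j(2)]
    by (intro exI[of _ "j + k"]) auto
qed

lemma reaches_loop:
  assumes "\<And>i c. i < n \<Longrightarrow> J i c \<Longrightarrow> reaches P b c (J (Suc i))" "J 0 c"
  shows "reaches P (n * b) c (J n)"
proof -
  have "m \<le> n \<Longrightarrow> reaches P (m * b) c (J m)" for m
  proof (induction m)
    case 0
    then show ?case using assms(2) by (intro reaches_run[where k = 0]) auto
  next
    case (Suc m)
    then have "reaches P (m * b + b) c (J (Suc m))"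
      using assms(1) by (intro reaches_trans[of _ "m * b" _ "J m"]) auto
    then show ?case by (simp add: add.commute)
  qed
  then show ?thesis by simp
qed

definition cltsp_prog :: "instr list" where
  "cltsp_prog =
    [IConst 2 1,
     \<comment> \<open>1: real registers 1 and 2 become the minimum and maximum of \<open>0\<close> and the input\<close>
     IJumpLess 1 0 3,
     Jump 10,
     Load 3 1,
     RJumpLess 3 2 6,
     RMove 2 3,
     RJumpLess 1 3 8,
     RMove 1 3,
     IAdd 1 1 2,
     Jump 1,
     \<comment> \<open>10: \<open>F\<close> and \<open>G\<close> in registers 2 and 1, the direction of \<open>F\<close> in register 5\<close>
     RSub 1 4 1,
     RConst 5 1,
     RJumpLess 1 2 17,
     RConst 5 (-1),
     RMove 6 1,
     RMove 1 2,
     RMove 2 6,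
     \<comment> \<open>17: the turning points \<open>p\<close> and \<open>q\<close> in registers 2 and 1\<close>
     RConst 6 1,
     RAdd 6 6 0,
     RDiv 2 2 6,
     RAdd 7 2 2,
     RMul 8 0 7,
     RSub 1 1 8,
     RDiv 1 1 6,
     RJumpLess 4 1 26,
     RMove 1 4,
     IConst 1 0,
     IMove 3 0,
     \<comment> \<open>28: each start is overwritten by its meeting time\<close>
     IJumpLess 1 0 30,
     Jump 47,
     Load 3 1,
     RMul 3 3 5,
     RJumpLess 3 4 37,
     RJumpLess 3 2 35,
     RMove 3 2,
     RMove 9 3,
     Jump 41,
     RSub 9 4 1,
     RJumpLess 9 3 40,
     RMove 3 9,
     RSub 9 7 3,
     RMul 3 3 5,
     Store 1 9,
     Store 3 3,
     IAdd 1 1 2,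
     IAdd 3 3 2,
     Jump 28,
     RAdd 9 7 1,
     RAdd 9 9 1,
     Store 3 9,
     Halt]"

lemma length_cltsp_prog: "length cltsp_prog = 51"
  by (simp add: cltsp_prog_def)


text \<open>Unfolds the program only under an index, so that it stays folded inside
  \<open>run\<close> during symbolic execution.\<close>

lemmas cltsp_fetch = arg_cong[OF cltsp_prog_def, of "\<lambda>P. P ! k"] for k

lemmas machine_simps =
  run_numeral step_def length_cltsp_prog cltsp_fetch set_ireg_def set_rreg_def set_mem_def branch_def

text \<open>Inserting 0 gives an empty prefix or an empty side the origin as its extreme, matching
  the initial register contents.\<close>

definition hi :: "(nat \<Rightarrow> real) \<Rightarrow> nat \<Rightarrow> real" where
  "hi m i = Max (insert 0 (m ` {..<i}))"

definition lo :: "(nat \<Rightarrow> real) \<Rightarrow> nat \<Rightarrow> real" where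
  "lo m i = Min (insert 0 (m ` {..<i}))"

lemma hi_lo_0: "hi m 0 = 0" "lo m 0 = 0"
  by (simp_all add: hi_def lo_def)

lemma hi_lo_Suc: "hi m (Suc i) = max (m i) (hi m i)" "lo m (Suc i) = min (m i) (lo m i)"
  by (simp_all add: hi_def lo_def lessThan_Suc insert_commute[of 0])

lemma hi_lo_bounds:
  "0 \<le> hi m n" "lo m n \<le> 0" "i < n \<Longrightarrow> m i \<le> hi m n" "i < n \<Longrightarrow> lo m n \<le> m i"
  by (auto simp: hi_def lo_def)

lemma hi_lo_attained:
  "hi m n = 0 \<or> (\<exists>i<n. m i = hi m n)" "lo m n = 0 \<or> (\<exists>i<n. m i = lo m n)"
proof -
  have "hi m n \<in> insert 0 (m ` {..<n})" "lo m n \<in> insert 0 (m ` {..<n})"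
    unfolding hi_def lo_def by (intro Max_in Min_in; simp)+
  then show "hi m n = 0 \<or> (\<exists>i<n. m i = hi m n)" "lo m n = 0 \<or> (\<exists>i<n. m i = lo m n)"
    by fastforce+
qed

section \<open>Loop invariants and step counts\<close>

definition scan_inv :: "nat \<Rightarrow> real \<Rightarrow> (nat \<Rightarrow> real) \<Rightarrow> nat \<Rightarrow> config \<Rightarrow> bool" where
  "scan_inv n v m i c \<longleftrightarrow> pc c = 1 \<and> ireg c 0 = n \<and> ireg c 1 = i \<and> ireg c 2 = 1 \<and>
     rreg c 0 = v \<and> rreg c 1 = lo m i \<and> rreg c 2 = hi m i \<and> rreg c 4 = 0 \<and> mem c = m"

text \<open>The conversion is in place: starts not yet read, in cells \<open>i\<close> to
  \<open>n - 1\<close>, are still intact. Real register 4 is never written and serves as the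
  constant 0.\<close>

definition write_inv ::
    "nat \<Rightarrow> real \<Rightarrow> real \<Rightarrow> real \<Rightarrow> (nat \<Rightarrow> real) \<Rightarrow> nat \<Rightarrow> config \<Rightarrow> bool" where
  "write_inv n g p q m i c \<longleftrightarrow> pc c = 28 \<and> ireg c 0 = n \<and> ireg c 1 = i \<and> ireg c 2 = 1 \<and>
     ireg c 3 = n + i \<and> rreg c 1 = q \<and> rreg c 2 = p \<and> rreg c 4 = 0 \<and> rreg c 5 = g \<and>
     rreg c 7 = 2 * p \<and>
     mem c = (\<lambda>k. if k < i then meet_time p q (g * m k)
       else if n \<le> k \<and> k < n + i then g * meet_pos p q (g * m (k - n)) else m k)"

lemma scan_step:
  assumes "i < n" "scan_inv n v m i c"
  shows "reaches cltsp_prog 8 c (scan_inv n v m (Suc i))"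
proof -
  note * = assms[unfolded scan_inv_def]
  \<comment> \<open>The two comparisons determine the path and thus the exact step count; two
    updates give the maximum 8.\<close>
  consider "m i < hi m i" "lo m i < m i" | "m i < hi m i" "\<not> lo m i < m i"
    | "\<not> m i < hi m i" "lo m i < m i" | "\<not> m i < hi m i" "\<not> lo m i < m i" by blast
  then show ?thesis
  proof cases
    case 1
    with * show ?thesis
      by (intro reaches_run[where k = 6]) (auto simp: machine_simps scan_inv_def hi_lo_Suc)
  next
    case 2
    with * show ?thesis
      by (intro reaches_run[where k = 7]) (auto simp: machine_simps scan_inv_def hi_lo_Suc)
  next
    case 3
    with * show ?thesis
      by (intro reaches_run[where k = 7]) (auto simp: machine_simps scan_inv_def hi_lo_Suc)
  next
    case 4
    with * show ?thesis
      by (intro reaches_run[where k = 8]) (auto simp: machine_simps scan_inv_def hi_lo_Suc)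
  qed
qed

lemma write_step:
  assumes "i < n" "write_inv n g p q m i c"
  shows "reaches cltsp_prog 14 c (write_inv n g p q m (Suc i))"
proof -
  note * = assms[unfolded write_inv_def]
  let ?y = "m i * g"
  consider "?y < 0" "- q < ?y" | "?y < 0" "\<not> - q < ?y"
    | "\<not> ?y < 0" "?y < p" | "\<not> ?y < 0" "\<not> ?y < p" by blast
  then show ?thesis
  proof cases
    case 1
    with * show ?thesis
      by (intro reaches_run[where k = 13])
        (auto simp: machine_simps write_inv_def meet_time_def meet_pos_def mult.commute fun_eq_iff)
  next
    case 2
    with * show ?thesis
      by (intro reaches_run[where k = 14])
        (auto simp: machine_simps write_inv_def meet_time_def meet_pos_def mult.commute fun_eq_iff)
  next
    case 3
    with * show ?thesis
      by (intro reaches_run[where k = 13])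
        (auto simp: machine_simps write_inv_def meet_time_def meet_pos_def mult.commute fun_eq_iff)
  next
    case 4
    with * show ?thesis
      by (intro reaches_run[where k = 14])
        (auto simp: machine_simps write_inv_def meet_time_def meet_pos_def mult.commute fun_eq_iff)
  qed
qed

lemma start_step:
  "reaches cltsp_prog 1 (input_config I as)
     (scan_inv (length as) (speed I) (mem (input_config I as)) 0)"
  by (rule reaches_run[where k = 1])
    (simp_all add: machine_simps scan_inv_def input_config_def hi_lo_0)

text \<open>The jump is strict, so a tie selects direction \<open>-1\<close>; then
  \<open>F = G\<close>. The longest path swaps the extremes and resets a nonpositive
  \<open>q\<close> to 0, taking 20 steps.\<close>

lemma prepare_step:
  fixes v :: real
  assumes "scan_inv n v m n c" "0 < v"
    and "g = (if - lo m n < hi m n then 1 else - 1)"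
    and "F = max (hi m n) (- lo m n)" "G = min (hi m n) (- lo m n)"
  shows "reaches cltsp_prog 20 c (write_inv n g (turn1 v F) (turn2 v F G) m 0)"
proof -
  note * = assms(1)[unfolded scan_inv_def]
  \<comment> \<open>\<open>RDiv\<close> has no successor when the divisor is 0.\<close>
  have nz: "1 + v \<noteq> 0" using \<open>0 < v\<close> by simp
  \<comment> \<open>This is the value before clamping at 0; \<open>2 * p\<close> is a sum because
    register 7 is computed by addition.\<close>
  let ?q = "(G - v * (F / (1 + v) + F / (1 + v))) / (1 + v)"
  show ?thesis
  proof (cases "- lo m n < hi m n")
    case True
    then have dir: "- lo m n < hi m n" "F = hi m n" "G = - lo m n" "g = 1"
      using assms by auto
    show ?thesis
    proof (cases "0 < ?q")
      case True
      with * dir nz show ?thesis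
        by (intro reaches_run[where k = 15])
          (auto simp: machine_simps write_inv_def turn1_def turn2_def)
    next
      case False
      with * dir nz show ?thesis
        by (intro reaches_run[where k = 16])
          (auto simp: machine_simps write_inv_def turn1_def turn2_def)
    qed
  next
    case False
    then have dir: "\<not> - lo m n < hi m n" "F = - lo m n" "G = hi m n" "g = - 1"
      using assms by auto
    show ?thesis
    proof (cases "0 < ?q")
      case True
      with * dir nz show ?thesis
        by (intro reaches_run[where k = 19])
          (auto simp: machine_simps write_inv_def turn1_def turn2_def)
    next
      case False
      with * dir nz show ?thesis
        by (intro reaches_run[where k = 20])
          (auto simp: machine_simps write_inv_def turn1_def turn2_def)
    qed
  qed
qed

text \<open>The end position is never stored: cell \<open>2 * n + 1\<close> still holds the 0
  supplied by the hypothesis on \<open>m\<close>.\<close>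

lemma finish_step:
  assumes "write_inv n g p q m n c" "\<And>k. n \<le> k \<Longrightarrow> m k = 0"
  shows "reaches cltsp_prog 5 c (\<lambda>d. pc d = 50 \<and>
    (\<forall>i<n. mem d i = meet_time p q (g * m i) \<and> mem d (n + i) = g * meet_pos p q (g * m i)) \<and>
    mem d (2 * n) = 2 * p + 2 * q \<and> mem d (2 * n + 1) = 0)"
  using assms unfolding write_inv_def
  by (intro reaches_run[where k = 5]) (auto simp: machine_simps)

text \<open>Start, scan, preparation, output pass and finish take at most \<open>1\<close>,
  \<open>8 * n\<close>, \<open>20\<close>, \<open>14 * n\<close> and \<open>5\<close> steps.\<close>

lemma cltsp_prog_run:
  fixes I :: "'a cltsp" and as :: "'a list"
  defines "n \<equiv> length as" and "m \<equiv> mem (input_config I as)"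
  assumes v: "0 < speed I"
    and g: "g = (if - lo m n < hi m n then 1 else - 1)"
    and FG: "F = max (hi m n) (- lo m n)" "G = min (hi m n) (- lo m n)"
  shows "\<exists>c. halts_within cltsp_prog (22 * n + 26) (input_config I as) c \<and>
    output_solution as c (tour I g (turn1 (speed I) F) (turn2 (speed I) F G))"
proof -
  let ?p = "turn1 (speed I) F" and ?q = "turn2 (speed I) F G"
  let ?final = "\<lambda>d. pc d = 50 \<and>
    (\<forall>i<n. mem d i = meet_time ?p ?q (g * m i) \<and>
      mem d (n + i) = g * meet_pos ?p ?q (g * m i)) \<and>
    mem d (2 * n) = 2 * ?p + 2 * ?q \<and> mem d (2 * n + 1) = 0"
  have start: "reaches cltsp_prog 1 (input_config I as) (scan_inv n (speed I) m 0)"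
    unfolding n_def m_def by (rule start_step)
  have scan: "reaches cltsp_prog (n * 8) c (scan_inv n (speed I) m n)"
    if "scan_inv n (speed I) m 0 c" for c
    by (rule reaches_loop[where J = "scan_inv n (speed I) m", OF scan_step that])
  have emit: "reaches cltsp_prog (n * 14) c (write_inv n g ?p ?q m n)"
    if "write_inv n g ?p ?q m 0 c" for c
    by (rule reaches_loop[where J = "write_inv n g ?p ?q m", OF write_step that])
  have prepare: "reaches cltsp_prog 20 c (write_inv n g ?p ?q m 0)"
    if "scan_inv n (speed I) m n c" for c
    by (rule prepare_step[OF that v g FG])
  have finish: "reaches cltsp_prog 5 c ?final" if "write_inv n g ?p ?q m n c" for c
    by (rule finish_step[OF that]) (simp add: input_config_def n_def m_def)
  have "reaches cltsp_prog (1 + (n * 8 + (20 + (n * 14 + 5)))) (input_config I as) ?final"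
    by (rule reaches_trans[OF start reaches_trans[OF scan
            reaches_trans[OF prepare reaches_trans[OF emit finish]]]])
  moreover have total: "1 + (n * 8 + (20 + (n * 14 + 5))) = 22 * n + 26" by simp
  ultimately obtain k c where "k \<le> 22 * n + 26" "run cltsp_prog k (input_config I as) = Some c"
    and c: "?final c"
    unfolding reaches_def total by blast
  moreover have "cltsp_prog ! 50 = Halt" by (simp add: cltsp_fetch)
  ultimately have "halts_within cltsp_prog (22 * n + 26) (input_config I as) c"
    unfolding halts_within_def by (auto simp: length_cltsp_prog)
  moreover have "output_solution as c (tour I g ?p ?q)"
    using c by (auto simp: output_solution_def tour_def Let_def n_def m_def input_config_def)
  ultimately show ?thesis by blast
qed

theorem theorem1:
  "\<exists>(P :: instr list) (T :: nat \<Rightarrow> nat).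
     (\<lambda>n. real (T n)) \<in> O(\<lambda>n. real n) \<and>
     computes_optimal_within P
       (\<lambda>I :: 'a cltsp.
          (\<forall>a\<in>clients I. proc I a = 0) \<and>
          (\<forall>a\<in>clients I. release I a = 0 \<and> deadline I a = \<infinity>) \<and>
          0 < speed I \<and> speed I < 1)
       T"
proof (intro exI conjI)
  let ?T = "\<lambda>n::nat. 22 * n + 26"
  show "(\<lambda>n. real (?T n)) \<in> O(\<lambda>n. real n)"
    \<comment> \<open>The constant is \<open>22 + 26\<close>, which suffices once
      \<open>n >= 1\<close>.\<close>
    by (intro bigoI[where c = 48] eventually_sequentiallyI[of 1]) simp
  show "computes_optimal_within cltsp_prog
       (\<lambda>I :: 'a cltsp.
          (\<forall>a\<in>clients I. proc I a = 0) \<and>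
          (\<forall>a\<in>clients I. release I a = 0 \<and> deadline I a = \<infinity>) \<and>
          0 < speed I \<and> speed I < 1)
       ?T"
    unfolding computes_optimal_within_def
  proof (intro allI impI, elim conjE)
    fix I :: "'a cltsp" and as :: "'a list"
    assume I: "cltsp_instance I" and v: "0 < speed I" "speed I < 1"
      and as: "distinct as" "set as = clients I"
      and "\<forall>a\<in>clients I. proc I a = 0"
        "\<forall>a\<in>clients I. release I a = 0 \<and> deadline I a = \<infinity>"
    then have timeless: "timeless I" by (simp add: timeless_def)
    define n m where "n = length as" and "m = mem (input_config I as)"
    define g :: real where "g = (if - lo m n < hi m n then 1 else - 1)"
    define F where "F = max (hi m n) (- lo m n)"
    define G where "G = min (hi m n) (- lo m n)"
    let ?S = "tour I g (turn1 (speed I) F) (turn2 (speed I) F G)"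
    have m: "m i = start I (as ! i)" if "i < n" for i
      using that by (simp add: m_def n_def input_config_def)
    have client: "as ! i \<in> clients I" if "i < n" for i
      using that as(2) nth_mem unfolding n_def by blast
    have attained: "y = 0 \<or> (\<exists>a\<in>clients I. start I a = y)" if "y = 0 \<or> (\<exists>i<n. m i = y)" for y
      using that client m by metis
    have bounds: "lo m n \<le> start I a" "start I a \<le> hi m n" if a: "a \<in> clients I" for a
    proof -
      obtain i where "i < n" "as ! i = a"
        using a as(2) unfolding n_def by (metis in_set_conv_nth)
      then show "lo m n \<le> start I a" "start I a \<le> hi m n"
        using hi_lo_bounds(3,4)[of i n m] m by auto
    qed
    have "optimal I ?S"
    proof (rule tour_optimal[OF I timeless v])
      show "\<bar>g\<bar> = 1" by (simp add: g_def)
      show "0 \<le> G" "G \<le> F" using hi_lo_bounds(1,2)[of m n] by (auto simp: F_def G_def)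
      show "F = 0 \<or> (\<exists>a\<in>clients I. g * start I a = F)"
        using attained[OF hi_lo_attained(1)[of m n]] attained[OF hi_lo_attained(2)[of m n]]
        by (auto simp: F_def g_def max_def)
      show "G = 0 \<or> (\<exists>a\<in>clients I. - g * start I a = G)"
        using attained[OF hi_lo_attained(1)[of m n]] attained[OF hi_lo_attained(2)[of m n]]
        by (auto simp: G_def g_def min_def)
      show "- G \<le> g * start I a \<and> g * start I a \<le> F" if "a \<in> clients I" for a
        using bounds[OF that] by (auto simp: F_def G_def g_def)
    qed
    moreover have "card (clients I) = length as" using as by (metis distinct_card)
    ultimately show "\<exists>c S. halts_within cltsp_prog (?T (card (clients I))) (input_config I as) c \<and>
        output_solution as c S \<and> optimal I S"
      using cltsp_prog_run[OF v(1) g_def[unfolded n_def m_def]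
          F_def[unfolded n_def m_def] G_def[unfolded n_def m_def]]
      by (metis F_def G_def g_def m_def n_def)
  qed
qed

end
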